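(* Let $H$ be a Hilbert space. Then, for any densely defined linear operator $T:D(T)\subset H\to H$ with finite rank, there exists a dense subset $X\subset H$ with $X\subset D(T)$ and a bounded linear operator $\widehat T:H\to H$ such that $$T|_X=\widehat T|_X.$$
   Context: $T$ has finite rank if its range is finite-dimensional; $T$ is not assumed bounded or closed. *)

theory Defs
  imports "HOL-Analysis.Analysis"
begin

text \<open>
  The scalars of a Hilbert space are real or complex. The library has only real inner products
  (class \<open>real_inner\<close>), so both cases are treated at once: a commutative real normed
  field with multiplicative norm is \<open>\<real>\<close> or \<open>\<complex>\<close> (Gelfand--Mazur), and
  the last axiom forces \<open>scalar_conj\<close> to be the usual conjugation.
\<close>

class hilbert_scalar = real_normed_field +
  fixes scalar_conj :: "'a \<Rightarrow> 'a"
  assumes scalar_conj_add: "scalar_conj (a + b) = scalar_conj a + scalar_conj b"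
    and scalar_conj_mult: "scalar_conj (a * b) = scalar_conj a * scalar_conj b"
    and scalar_conj_conj: "scalar_conj (scalar_conj a) = a"
    and mult_scalar_conj: "a * scalar_conj a = scaleR ((norm a)\<^sup>2) 1"

instantiation real :: hilbert_scalar
begin

definition scalar_conj_real :: "real \<Rightarrow> real" where
  "scalar_conj_real a = a"

instance
  by standard (auto simp: scalar_conj_real_def power2_eq_square)

end

instantiation complex :: hilbert_scalar
begin

definition scalar_conj_complex :: "complex \<Rightarrow> complex" where
  "scalar_conj_complex a = cnj a"

instance
proof
  show "a * scalar_conj a = scaleR ((norm a)\<^sup>2) 1" for a :: complex
    unfolding scalar_conj_complex_def scaleR_conv_of_real
    by (simp only: complex_norm_square mult_1_right)
qed (simp_all add: scalar_conj_complex_def)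

end

text \<open>
  Norm, topology and completeness are those of the type; \<open>ip_self\<close> says that the norm is
  the one induced by the inner product, which gives positive definiteness.
\<close>

locale hilbert_space = vector_space smul
  for smul :: "'k::hilbert_scalar \<Rightarrow> 'a::{real_normed_vector, complete_space} \<Rightarrow> 'a" +
  fixes ip :: "'a \<Rightarrow> 'a \<Rightarrow> 'k"
  assumes scale_of_real: "smul (of_real r) x = r *\<^sub>R x"
    and ip_add_left: "ip (x + y) z = ip x z + ip y z"
    and ip_scale_left: "ip (smul c x) y = c * ip x y"
    and ip_commute: "ip y x = scalar_conj (ip x y)"
    and ip_self: "ip x x = of_real ((norm x)\<^sup>2)"

lemma hilbert_space_real:
  "hilbert_space scaleR (inner :: 'a::{real_inner, complete_space} \<Rightarrow> 'a \<Rightarrow> real)"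
proof unfold_locales
  show "x \<bullet> x = of_real ((norm x)\<^sup>2)" for x :: 'a
    by (simp add: power2_norm_eq_inner)
  show "y \<bullet> x = scalar_conj (x \<bullet> y)" for x y :: 'a
    by (simp add: scalar_conj_real_def inner_commute)
qed (simp_all add: inner_add_left scaleR_add_left scaleR_add_right)

lemma hilbert_space_complex:
  "hilbert_space (*) (\<lambda>x y :: complex. x * cnj y)"
proof unfold_locales
  show "x * cnj x = of_real ((norm x)\<^sup>2)" for x :: complex
    by (rule complex_norm_square [symmetric])
qed (simp_all add: scalar_conj_complex_def scaleR_conv_of_real distrib_left distrib_right)

text \<open>
  An operator with domain \<open>D\<close> is a function of which only the values on \<open>D\<close> matter.
\<close>

definition linear_operator_on ::
    "('k::hilbert_scalar \<Rightarrow> 'a::real_normed_vector \<Rightarrow> 'a) \<Rightarrow> 'a set \<Rightarrow> ('a \<Rightarrow> 'a) \<Rightarrow> bool" where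
  "linear_operator_on smul D T \<longleftrightarrow>
     module.subspace smul D \<and>
     (\<forall>x\<in>D. \<forall>y\<in>D. T (x + y) = T x + T y) \<and>
     (\<forall>c. \<forall>x\<in>D. T (smul c x) = smul c (T x))"

definition densely_defined_operator ::
    "('k::hilbert_scalar \<Rightarrow> 'a::real_normed_vector \<Rightarrow> 'a) \<Rightarrow> 'a set \<Rightarrow> ('a \<Rightarrow> 'a) \<Rightarrow> bool" where
  "densely_defined_operator smul D T \<longleftrightarrow> linear_operator_on smul D T \<and> closure D = UNIV"

definition finite_rank_on ::
    "('k::hilbert_scalar \<Rightarrow> 'a::real_normed_vector \<Rightarrow> 'a) \<Rightarrow> 'a set \<Rightarrow> ('a \<Rightarrow> 'a) \<Rightarrow> bool" where
  "finite_rank_on smul D T \<longleftrightarrow> (\<exists>B. finite B \<and> module.span smul B = T ` D)"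

text \<open>
  The library's \<open>bounded_linear\<close> only asks for real-linearity.
\<close>

definition bounded_linear_operator ::
    "('k::hilbert_scalar \<Rightarrow> 'a::real_normed_vector \<Rightarrow> 'a) \<Rightarrow> ('a \<Rightarrow> 'a) \<Rightarrow> bool" where
  "bounded_linear_operator smul S \<longleftrightarrow>
     Vector_Spaces.linear smul smul S \<and> (\<exists>K. \<forall>x. norm (S x) \<le> K * norm x)"

end

theory Submission imports Defs begin

text \<open>
  Only the unbounded directions of \<open>T\<close> obstruct an extension, and there are finitely many of
  them. Expand \<open>T x\<close> in a basis \<open>B\<close> of the range; the coordinates are linear functionals
  on the domain. If they are all bounded, so is \<open>T\<close>, and it extends by continuity to the closure
  of its domain, which is the whole space. If one of them, say the coordinate at \<open>b\<close>, is
  unbounded, then its kernel is dense in the domain (\<open>kernel_dense_if_unbounded\<close>), and on this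
  kernel \<open>T\<close> takes values in the span of \<open>B - {b}\<close>. Shrinking the domain in this way
  lowers the rank without losing density, so after finitely many steps a dense subspace is left on
  which \<open>T\<close> is bounded (\<open>bounded_on_dense_subspace\<close>).
\<close>

context hilbert_space
begin

lemma norm_smul: "norm (smul c x) = norm c * norm x"
proof -
  have self_conj: "scalar_conj (ip x x) = ip x x"
    by (rule ip_commute[symmetric])
  have "ip (smul c x) (smul c x) = c * scalar_conj (c * ip x x)"
    by (simp add: ip_scale_left ip_commute[of x "smul c x"])
  also have "\<dots> = (c * scalar_conj c) * ip x x"
    by (simp add: scalar_conj_mult self_conj)
  also have "\<dots> = of_real ((norm c * norm x)\<^sup>2)"
    by (simp add: mult_scalar_conj ip_self scaleR_conv_of_real power_mult_distrib)
  finally have "(of_real ((norm (smul c x))\<^sup>2) :: 'k) = of_real ((norm c * norm x)\<^sup>2)"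
    by (simp only: ip_self)
  then have "(norm (smul c x))\<^sup>2 = (norm c * norm x)\<^sup>2"
    by (simp only: of_real_eq_iff)
  then show ?thesis
    by (simp add: power2_eq_iff_nonneg)
qed

lemma bounded_linear_smul: "bounded_linear (smul c)"
proof (rule bounded_linear_intro)
  show "smul c (x + y) = smul c x + smul c y" for x y
    by (rule scale_right_distrib)
  show "smul c (r *\<^sub>R x) = r *\<^sub>R smul c x" for r x
    by (simp add: scale_of_real[symmetric] mult.commute)
  show "norm (smul c x) \<le> norm x * norm c" for x
    by (simp add: norm_smul mult.commute)
qed

text \<open>
  A vector \<open>x\<close> that is short compared with \<open>f x\<close> can correct any \<open>y\<close>: subtracting
  \<open>f y / f x\<close> times \<open>x\<close> kills the value of \<open>f\<close> and moves \<open>y\<close> only slightly.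
\<close>

lemma kernel_dense_if_unbounded:
  assumes D: "subspace D"
    and add: "\<And>x y. x \<in> D \<Longrightarrow> y \<in> D \<Longrightarrow> f (x + y) = f x + f y"
    and scale: "\<And>c x. x \<in> D \<Longrightarrow> f (smul c x) = c * f x"
    and unbounded: "\<nexists>K. \<forall>x\<in>D. norm (f x) \<le> K * norm x"
  shows "D \<subseteq> closure {x \<in> D. f x = (0::'k)}"
proof
  fix y assume y: "y \<in> D"
  show "y \<in> closure {x \<in> D. f x = 0}"
    unfolding closure_approachable
  proof (intro allI impI)
    fix e :: real assume e: "e > 0"
    \<comment> \<open>This constant makes the correction \<open>(f y / f x) x\<close> shorter than \<open>e\<close>.\<close>
    obtain x where x: "x \<in> D" and big: "norm (f y) / e * norm x < norm (f x)"
      using unbounded by (meson not_le)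
    have "0 \<le> norm (f y) / e * norm x"
      using e by simp
    with big have "f x \<noteq> 0"
      by auto
    define z where "z = y + smul (- (f y / f x)) x"
    have "z \<in> D"
      unfolding z_def using D x y by (intro subspace_add subspace_scale)
    moreover have "f z = 0"
      unfolding z_def using D x y \<open>f x \<noteq> 0\<close>
      by (simp add: add scale subspace_scale del: scale_minus_left)
    moreover have "dist z y < e"
    proof -
      have "dist z y = norm (f y) / norm (f x) * norm x"
        unfolding z_def dist_norm by (simp add: norm_smul norm_divide)
      also have "\<dots> < e"
        using big e \<open>f x \<noteq> 0\<close> by (simp add: field_simps)
      finally show ?thesis .
    qed
    ultimately show "\<exists>z\<in>{x \<in> D. f x = 0}. dist z y < e"
      by blast
  qed
qed

text \<open>
  Each passage to the kernel of an unbounded coordinate removes one element of \<open>B\<close>, so the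
  process ends, at the latest with \<open>B\<close> empty and \<open>T = 0\<close>. Independence of \<open>B\<close>
  makes the coordinates well defined and linear.
\<close>

lemma bounded_on_dense_subspace:
  assumes "finite B" and "independent B"
    and "linear_operator_on smul D T" and "closure D = UNIV" and "T ` D \<subseteq> span B"
  obtains X K where "X \<subseteq> D" and "closure X = UNIV" and "linear_operator_on smul X T"
    and "\<forall>x\<in>X. norm (T x) \<le> K * norm x"
proof -
  have "\<exists>X K. X \<subseteq> D \<and> closure X = UNIV \<and> linear_operator_on smul X T \<and>
      (\<forall>x\<in>X. norm (T x) \<le> K * norm x)"
    using assms
  proof (induction B arbitrary: D rule: finite_psubset_induct)
    case (psubset B)
    define coord where "coord b x = representation B (T x) b" for b x
    have D: "subspace D"
      and add: "\<And>x y. x \<in> D \<Longrightarrow> y \<in> D \<Longrightarrow> T (x + y) = T x + T y"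
      and scale: "\<And>c x. x \<in> D \<Longrightarrow> T (smul c x) = smul c (T x)"
      using psubset.prems(2) by (auto simp: linear_operator_on_def)
    have in_span: "T x \<in> span B" if "x \<in> D" for x
      using psubset.prems(4) that by blast
    have expand: "T x = (\<Sum>b\<in>B. smul (coord b x) b)" if "x \<in> D" for x
      unfolding coord_def
      using sum_representation_eq[OF psubset.prems(1) in_span[OF that] psubset.hyps order_refl]
      by simp
    have coord_add: "coord b (x + y) = coord b x + coord b y" if "x \<in> D" "y \<in> D" for b x y
      using that by (simp add: coord_def add representation_add psubset.prems(1) in_span)
    have coord_scale: "coord b (smul c x) = c * coord b x" if "x \<in> D" for b c x
      using that by (simp add: coord_def scale representation_scale psubset.prems(1) in_span)
    show ?case
    proof (cases "\<forall>b\<in>B. \<exists>K. \<forall>x\<in>D. norm (coord b x) \<le> K * norm x")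
      case True
      then obtain K where K: "\<And>b x. b \<in> B \<Longrightarrow> x \<in> D \<Longrightarrow> norm (coord b x) \<le> K b * norm x"
        by metis
      have "norm (T x) \<le> (\<Sum>b\<in>B. K b * norm b) * norm x" if x: "x \<in> D" for x
      proof -
        have "norm (T x) \<le> (\<Sum>b\<in>B. norm (coord b x) * norm b)"
          unfolding expand[OF x] by (rule sum_norm_le) (simp add: norm_smul)
        also have "\<dots> \<le> (\<Sum>b\<in>B. (K b * norm x) * norm b)"
          by (intro sum_mono mult_right_mono K x) auto
        finally show ?thesis
          by (simp add: sum_distrib_right mult.assoc mult.commute[of "norm x"])
      qed
      then show ?thesis
        using psubset.prems(2,3) by blast
    next
      case False
      then obtain b where b: "b \<in> B"
        and unbounded: "\<nexists>K. \<forall>x\<in>D. norm (coord b x) \<le> K * norm x"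
        by blast
      define E where "E = {x \<in> D. coord b x = 0}"
      have "D \<subseteq> closure E"
        unfolding E_def using D coord_add coord_scale unbounded
        by (rule kernel_dense_if_unbounded)
      then have "closure E = UNIV"
        using closure_minimal[of D "closure E"] psubset.prems(3) by auto
      moreover have "linear_operator_on smul E T"
      proof -
        have "coord b 0 = 0"
          using coord_scale[OF subspace_0[OF D], of b 0] by simp
        then have "subspace E"
          using D coord_add coord_scale unfolding E_def subspace_def by auto
        then show ?thesis
          using add scale by (auto simp: linear_operator_on_def E_def)
      qed
      moreover have "T ` E \<subseteq> span (B - {b})"
      proof
        fix v assume "v \<in> T ` E"
        then obtain x where x: "x \<in> D" "coord b x = 0" and v: "v = T x"
          by (auto simp: E_def)
        have "v = (\<Sum>a\<in>B - {b}. smul (coord a x) a)"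
          unfolding v expand[OF x(1)] using psubset.hyps b x(2) by (simp add: sum.remove)
        then show "v \<in> span (B - {b})"
          by (simp only:) (intro span_sum span_scale span_base)
      qed
      moreover have "B - {b} \<subset> B" and "independent (B - {b})"
        using b psubset.prems(1) independent_mono[of B "B - {b}"] by auto
      ultimately obtain X K where "X \<subseteq> E" "closure X = UNIV" "linear_operator_on smul X T"
          "\<forall>x\<in>X. norm (T x) \<le> K * norm x"
        using psubset.IH[of "B - {b}" E] by blast
      moreover have "E \<subseteq> D"
        by (auto simp: E_def)
      ultimately show ?thesis
        by blast
    qed
  qed
  then show thesis
    using that by blast
qed

text \<open>
  The extension exists because a bounded linear map is Lipschitz, hence uniformly continuous. It is
  linear and bounded because linearity and the norm bound are closed conditions that hold on
  \<open>X\<close>.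
\<close>

lemma bounded_linear_operator_extension:
  assumes lin: "linear_operator_on smul X T"
    and dense: "closure X = UNIV"
    and bound: "\<forall>x\<in>X. norm (T x) \<le> K * norm x"
  obtains S where "bounded_linear_operator smul S" and "\<forall>x\<in>X. T x = S x"
proof -
  have X: "subspace X"
    and add: "\<And>x y. x \<in> X \<Longrightarrow> y \<in> X \<Longrightarrow> T (x + y) = T x + T y"
    and scale: "\<And>c x. x \<in> X \<Longrightarrow> T (smul c x) = smul c (T x)"
    using lin by (auto simp: linear_operator_on_def)
  have diff: "T x - T y = T (x - y)" if "x \<in> X" "y \<in> X" for x y
    using add[of "x - y" y] that subspace_diff[OF X] by simp
  have "\<bar>K\<bar>-lipschitz_on X T"
  proof (rule lipschitz_onI)
    fix x y assume "x \<in> X" "y \<in> X"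
    then have "dist (T x) (T y) \<le> K * dist x y"
      using bound subspace_diff[OF X] by (simp add: dist_norm diff)
    also have "\<dots> \<le> \<bar>K\<bar> * dist x y"
      by (intro mult_right_mono) auto
    finally show "dist (T x) (T y) \<le> \<bar>K\<bar> * dist x y" .
  qed simp
  then have "uniformly_continuous_on X T"
    by (rule lipschitz_on_uniformly_continuous)
  then obtain S where S: "uniformly_continuous_on (closure X) S"
      and agree: "\<And>x. x \<in> X \<Longrightarrow> T x = S x"
    by (rule uniformly_continuous_on_extension_on_closure) auto
  have cont: "continuous_on UNIV S"
    using S dense uniformly_continuous_imp_continuous by auto
  have cont_comp: "continuous_on UNIV (\<lambda>x. S (g x))" if "continuous_on UNIV g" for g :: "'a \<Rightarrow> 'a"
    by (rule continuous_on_compose2[OF cont that]) simp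
  have by_density: "P x" if "closed {x. P x}" "\<And>x. x \<in> X \<Longrightarrow> P x" for P :: "'a \<Rightarrow> bool" and x
    using closure_minimal[of X "{x. P x}"] that dense by auto
  \<comment> \<open>Density is used in one summand at a time.\<close>
  have S_add_X: "S (x + y) = S x + S y" if "y \<in> X" for x y
  proof (rule by_density[where P = "\<lambda>x. S (x + y) = S x + S y"])
    show "closed {x. S (x + y) = S x + S y}"
      by (intro closed_Collect_eq continuous_intros cont_comp cont)
    show "S (x + y) = S x + S y" if "x \<in> X" for x
      using that \<open>y \<in> X\<close> add[of x y] agree subspace_add[OF X] by simp
  qed
  have S_add: "S (x + y) = S x + S y" for x y
  proof (rule by_density[where P = "\<lambda>y. S (x + y) = S x + S y"])
    show "closed {y. S (x + y) = S x + S y}"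
      by (intro closed_Collect_eq continuous_intros cont_comp cont)
  qed (rule S_add_X)
  have S_scale: "S (smul c x) = smul c (S x)" for c x
  proof (rule by_density[where P = "\<lambda>x. S (smul c x) = smul c (S x)"])
    have cont_smul: "continuous_on UNIV (smul c)"
      by (rule linear_continuous_on[OF bounded_linear_smul])
    have "continuous_on UNIV (\<lambda>x. smul c (S x))"
      by (rule continuous_on_compose2[OF cont_smul cont]) simp
    then show "closed {x. S (smul c x) = smul c (S x)}"
      by (intro closed_Collect_eq cont_comp cont_smul)
    show "S (smul c x) = smul c (S x)" if "x \<in> X" for x
      using that scale[of x c] agree subspace_scale[OF X] by simp
  qed
  have S_bound: "norm (S x) \<le> K * norm x" for x
  proof (rule by_density[where P = "\<lambda>x. norm (S x) \<le> K * norm x"])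
    show "closed {x. norm (S x) \<le> K * norm x}"
      by (intro closed_Collect_le continuous_intros cont)
    show "norm (S x) \<le> K * norm x" if "x \<in> X" for x
      using that bound agree by simp
  qed
  have "Vector_Spaces.linear smul smul S"
    by (intro Vector_Spaces.linear.intro vector_space_axioms module_hom.intro module_axioms
        module_hom_axioms.intro S_add S_scale)
  then have "bounded_linear_operator smul S"
    unfolding bounded_linear_operator_def using S_bound by blast
  then show thesis
    using that agree by blast
qed

end

theorem lemma1p1:
  fixes smul :: "'k::hilbert_scalar \<Rightarrow> 'a::{real_normed_vector, complete_space} \<Rightarrow> 'a"
    and ip :: "'a \<Rightarrow> 'a \<Rightarrow> 'k"
    and D :: "'a set"
    and T :: "'a \<Rightarrow> 'a"
  assumes "hilbert_space smul ip"
    and "densely_defined_operator smul D T"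
    and "finite_rank_on smul D T"
  shows "\<exists>X That. closure X = UNIV \<and> X \<subseteq> D \<and> bounded_linear_operator smul That \<and>
           (\<forall>x\<in>X. T x = That x)"
proof -
  interpret hilbert_space smul ip
    by fact
  have lin: "linear_operator_on smul D T" and dense: "closure D = UNIV"
    using assms(2) by (auto simp: densely_defined_operator_def)
  obtain C where C: "finite C" "span C = T ` D"
    using assms(3) by (auto simp: finite_rank_on_def)
  obtain B where B: "B \<subseteq> C" "independent B" "C \<subseteq> span B"
    using maximal_independent_subset[of C] by blast
  have "finite B"
    using B(1) C(1) by (rule finite_subset)
  moreover have "T ` D \<subseteq> span B"
    using span_minimal[OF B(3) subspace_span] C(2) by simp
  ultimately obtain X K where X: "X \<subseteq> D" "closure X = UNIV"
      and lin_X: "linear_operator_on smul X T"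
      and bound: "\<forall>x\<in>X. norm (T x) \<le> K * norm x"
    using bounded_on_dense_subspace[OF _ B(2) lin dense] by blast
  obtain S where "bounded_linear_operator smul S" "\<forall>x\<in>X. T x = S x"
    using bounded_linear_operator_extension[OF lin_X X(2) bound] by blast
  with X show ?thesis
    by blast
qed

end
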